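(* Let $k \geq 1$ and $t \geq k+1$ be integers such that $2^t - 2^k - 1$ is prime. Then $n = 2^{t-1}(2^t - 2^k - 1)$ is a near-perfect number with redundant divisor $2^k$.
   Context: A proper divisor of a positive integer $n$ is a positive divisor of $n$ different from $n$. A positive integer $n$ is called near-perfect if it is the sum of all its proper divisors except for exactly one of them, $d = d(n)$; this divisor $d$ is called the redundant divisor of $n$. Equivalently, $n$ is near-perfect with redundant divisor $d$ if $d$ is a proper divisor of $n$ and $\sigma(n) - 2n = d$, where $\sigma(n)$ denotes the sum of all positive divisors of $n$. *)

theory Defs
  imports "HOL-Computational_Algebra.Primes"
begin

definition proper_divisors :: "nat \<Rightarrow> nat set" where
  "proper_divisors n = {d. d dvd n \<and> d \<noteq> n}"

text \<open>
  The redundant divisor \<open>d(n)\<close> is rendered as a relation, so that no junk value arises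
  when \<open>n\<close> is not near-perfect; it is functional by \<open>redundant_divisor_unique\<close>.
\<close>

definition redundant_divisor :: "nat \<Rightarrow> nat \<Rightarrow> bool" where
  "redundant_divisor n d \<longleftrightarrow>
     n > 0 \<and> d \<in> proper_divisors n \<and> n = \<Sum>(proper_divisors n - {d})"

definition near_perfect :: "nat \<Rightarrow> bool" where
  "near_perfect n \<longleftrightarrow> (\<exists>d. redundant_divisor n d)"

lemma finite_proper_divisors: "n > 0 \<Longrightarrow> finite (proper_divisors n)"
  unfolding proper_divisors_def by (rule finite_subset[of _ "{d. d dvd n}"]) auto

lemma redundant_divisor_sum:
  assumes "redundant_divisor n d"
  shows "\<Sum>(proper_divisors n) = n + d"
  using assms sum.remove[of "proper_divisors n" d "\<lambda>x. x"] finite_proper_divisors[of n]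
  unfolding redundant_divisor_def by simp

lemma redundant_divisor_unique:
  assumes "redundant_divisor n d" "redundant_divisor n d'"
  shows "d = d'"
  using redundant_divisor_sum[OF assms(1)] redundant_divisor_sum[OF assms(2)] by simp

end

theory Submission
  imports Defs
begin

text \<open>Write \<open>p = 2 ^ t - 2 ^ k - 1\<close>, which is odd because \<open>k\<close> and
  \<open>t\<close> are positive. Since \<sigma> is multiplicative, \<sigma>(n) = (2^t - 1)(p + 1) =
  2^t p + (2^t - 1 - p) = 2n + 2^k. As k \<le> t - 1 and p > 1, 2^k is a proper divisor of n, so it
  is the redundant one. The value of \<sigma> comes from an explicit list of divisors
  (\<open>sum_divisors_two_power_times_prime\<close>); \<open>redundant_divisorI\<close> turns the
  \<sigma> identity into the definition.\<close>

text \<open>A divisor of a product splits into a divisor of each factor, and both factors here have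
  known divisors.\<close>

lemma divisors_two_power_times_prime:
  fixes p m :: nat
  assumes "prime p"
  shows "{d. d dvd 2 ^ m * p} = (\<lambda>i. 2 ^ i) ` {..m} \<union> (\<lambda>i. 2 ^ i * p) ` {..m}"
proof (intro equalityI subsetI)
  fix d assume "d \<in> {d. d dvd 2 ^ m * p}"
  then obtain a b where ab: "d = a * b" "a dvd 2 ^ m" "b dvd p"
    by (auto dest: division_decomp)
  then obtain i where "i \<le> m" "a = 2 ^ i"
    using divides_primepow_nat[OF two_is_prime_nat] by blast
  moreover have "b = 1 \<or> b = p"
    using ab(3) assms by (simp add: prime_nat_iff)
  ultimately show "d \<in> (\<lambda>i. 2 ^ i) ` {..m} \<union> (\<lambda>i. 2 ^ i * p) ` {..m}"
    using ab(1) by auto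
qed (auto simp: le_imp_power_dvd mult_dvd_mono dvd_mult2)

lemma sum_divisors_two_power_times_prime:
  fixes p m :: nat
  assumes "prime p" and "odd p"
  shows "\<Sum>{d. d dvd 2 ^ m * p} = (2 ^ Suc m - 1) * (p + 1)"
proof -
  have "p > 0"
    using assms(1) by (rule prime_gt_0_nat)
  have disjoint: "(\<lambda>i. 2 ^ i) ` {..m} \<inter> (\<lambda>i. 2 ^ i * p) ` {..m} = {}"
  proof -
    \<comment> \<open>A common element would make the odd prime \<open>p\<close> divide a power of
      2.\<close>
    have "2 ^ i \<noteq> 2 ^ j * p" for i j :: nat
    proof
      assume "2 ^ i = 2 ^ j * p"
      then have "p dvd 2 ^ i" by simp
      then have "p dvd 2"
        using assms(1) by (rule prime_dvd_power_nat[rotated])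
      then show False
        using assms primes_dvd_imp_eq[of p 2] two_is_prime_nat by auto
    qed
    then show ?thesis by blast
  qed
  have "\<Sum>{d. d dvd 2 ^ m * p} = (\<Sum>i\<le>m. 2 ^ i) + (\<Sum>i\<le>m. 2 ^ i * p)"
    unfolding divisors_two_power_times_prime[OF assms(1)]
    using disjoint \<open>p > 0\<close>
    by (simp add: sum.union_disjoint sum.reindex inj_on_def)
  also have "\<dots> = (\<Sum>i\<le>m. 2 ^ i) * (p + 1)"
    by (simp add: sum_distrib_right)
  also have "(\<Sum>i\<le>m. 2 ^ i) = (2 ^ Suc m - 1 :: nat)"
    using mask_eq_sum_exp_nat[of "Suc m"] by (simp add: less_Suc_eq_le atMost_def)
  finally show ?thesis .
qed

text \<open>Of \<sigma>(n) = 2n + d, dropping \<open>n\<close> itself leaves n + d as the sum of the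
  proper divisors, and dropping \<open>d\<close> as well leaves n.\<close>

lemma redundant_divisorI:
  fixes n d :: nat
  assumes "n > 0" and "d dvd n" and "d \<noteq> n" and "\<Sum>{e. e dvd n} = 2 * n + d"
  shows "redundant_divisor n d"
proof -
  have d: "d \<in> proper_divisors n"
    using assms by (simp add: proper_divisors_def)
  have "{e. e dvd n} = insert n (proper_divisors n)"
    by (auto simp: proper_divisors_def)
  moreover have "n \<notin> proper_divisors n"
    by (simp add: proper_divisors_def)
  ultimately have "\<Sum>(proper_divisors n) = n + d"
    using assms(4) finite_proper_divisors[OF assms(1)] by simp
  then show ?thesis
    using d assms(1) finite_proper_divisors[OF assms(1)]
      sum.remove[of "proper_divisors n" d "\<lambda>x. x"]
    by (simp add: redundant_divisor_def)
qed

theorem theorem3: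
  fixes k t n :: nat
  assumes "k \<ge> 1" and "t \<ge> k + 1"
    and "prime ((2::nat) ^ t - 2 ^ k - 1)"
    and "n = 2 ^ (t - 1) * (2 ^ t - 2 ^ k - 1)"
  shows "near_perfect n \<and> redundant_divisor n (2 ^ k)"
proof -
  define p :: nat where "p = 2 ^ t - 2 ^ k - 1"
  have p: "prime p" and n: "n = 2 ^ (t - 1) * p"
    using assms by (simp_all add: p_def)
  have p_gt: "p > 1"
    using p by (rule prime_gt_1_nat)
  \<comment> \<open>Since \<open>p\<close> is positive, the natural-number subtractions defining it
    were not truncated.\<close>
  then have pow: "(2::nat) ^ t = p + 2 ^ k + 1"
    by (simp add: p_def)
  have "odd p"
  proof
    assume "even p"
    then have "odd ((2::nat) ^ t)"
      using pow assms(1) by simp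
    then show False
      using assms(2) by simp
  qed
  have t: "Suc (t - 1) = t"
    using assms(2) by simp
  have two_n: "2 * n = 2 ^ t * p"
    unfolding n by (subst (2) t[symmetric]) simp
  have "\<Sum>{e. e dvd n} = (2 ^ t - 1) * (p + 1)"
    using sum_divisors_two_power_times_prime[OF p \<open>odd p\<close>, of "t - 1"] by (simp only: n t)
  \<comment> \<open>With 2^t eliminated, this is (p + 2^k)(p + 1) = (p + 2^k + 1)p + 2^k.\<close>
  also have "\<dots> = 2 * n + 2 ^ k"
    unfolding two_n pow by (simp add: algebra_simps)
  finally have sum: "\<Sum>{e. e dvd n} = 2 * n + 2 ^ k" .
  \<comment> \<open>The divisor 2^k must differ from \<open>n\<close>: it is at most the 2-part of
    \<open>n\<close>, which is smaller than \<open>n\<close> because p > 1.\<close>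
  have "(2::nat) ^ k \<le> 2 ^ (t - 1)"
    using assms(2) by (intro power_increasing) auto
  also have "\<dots> < n"
    using p_gt by (simp add: n)
  finally have "2 ^ k < n" .
  moreover have "2 ^ k dvd n"
    using assms(2) unfolding n by (intro dvd_mult2 le_imp_power_dvd) simp
  ultimately have "redundant_divisor n (2 ^ k)"
    using sum by (intro redundant_divisorI) auto
  then show ?thesis
    by (auto simp: near_perfect_def)
qed

end
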